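(* Let $d\ge 1$, let $P,Q:\mathbb{R}^d\to\mathbb{R}^d$ and $R:=P+Q$. Assume that: (i) (Minty assumption) $x^*\in\mathbb{R}^d$ is a point such that $\langle R(x),x-x^*\rangle\ge 0$ for all $x\in\mathbb{R}^d$; (ii) $Q$ is $L_q$-Lipschitz and monotone; (iii) $P$ is $L_p$-Lipschitz with $L_p>0$. Let $K\ge 1$ be an integer, $x^0\in\mathbb{R}^d$, and let $(x^k)_{0\le k\le K}$, $(u^k)_{0\le k\le K-1}$, $(\tilde u^k)_{0\le k\le K-1}$ be generated by the Extragradient Sliding algorithm with starting point $x^0$ and parameters $$\theta=\frac{1}{2L_p},\qquad \eta=\frac{\theta}{2}.$$ Assume that for every $0\le k\le K-1$ the approximate solution $u^k$ satisfies $$\|B_\theta^k(u^k)\|^2\le \frac{L_p^2}{3}\,\|x^k-\tilde u^k\|^2 .$$ Then $$\min_{0\le j\le K-1}\|R(u^j)\|^2\le \frac{16L_p^2\,\|x^0-x^*\|^2}{K}.$$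
   Context: $\langle\cdot,\cdot\rangle$ and $\|\cdot\|$ are the standard Euclidean inner product and norm on $\mathbb{R}^d$. $Q$ is $L_q$-Lipschitz if $\|Q(x_1)-Q(x_2)\|\le L_q\|x_1-x_2\|$ for all $x_1,x_2\in\mathbb{R}^d$ (similarly for $P$ with $L_p$), and monotone if $\langle Q(x_1)-Q(x_2),x_1-x_2\rangle\ge 0$ for all $x_1,x_2$. $P$ is not assumed monotone. The problem to be solved is to find a zero of $R=P+Q$. Extragradient Sliding algorithm: given a starting point $x^0\in\mathbb{R}^d$, stepsizes $\eta,\theta>0$ and a number of iterations $K$, for $k=0,1,\dots,K-1$: define the operator $B_\theta^k(x):=P(x^k)+Q(x)+\frac1\theta(x-x^k)$, $x\in\mathbb{R}^d$; let $\tilde u^k\in\mathbb{R}^d$ be its zero, $B_\theta^k(\tilde u^k)=0$ (it exists and is unique, since $B_\theta^k$ is Lipschitz and $\frac1\theta$-strongly monotone); choose some approximation $u^k\in\mathbb{R}^d$ of $\tilde u^k$; set $x^{k+1}=x^k-\eta R(u^k)$. *)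

theory Defs
  imports "HOL-Analysis.Analysis"
begin

definition monotone_operator :: "(real ^ 'n \<Rightarrow> real ^ 'n) \<Rightarrow> bool" where
  "monotone_operator F \<longleftrightarrow> (\<forall>x y. (F x - F y) \<bullet> (x - y) \<ge> 0)"

definition sliding_operator ::
  "(real ^ 'n \<Rightarrow> real ^ 'n) \<Rightarrow> (real ^ 'n \<Rightarrow> real ^ 'n) \<Rightarrow> real \<Rightarrow> real ^ 'n \<Rightarrow> real ^ 'n \<Rightarrow> real ^ 'n" where
  "sliding_operator P Q \<theta> z x = P z + Q x + (1 / \<theta>) *\<^sub>R (x - z)"

text \<open>
  A run of the algorithm is a relation rather than a function, since each \<open>u k\<close> is an
  arbitrary approximation of the exact zero \<open>u' k\<close>; accuracy requirements on \<open>u\<close> are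
  stated separately. Only \<open>x 0, \<dots>, x K\<close> and the values of \<open>u\<close>, \<open>u'\<close> at indices below
  \<open>K\<close> are constrained.
\<close>

definition extragradient_sliding ::
  "(real ^ 'n \<Rightarrow> real ^ 'n) \<Rightarrow> (real ^ 'n \<Rightarrow> real ^ 'n) \<Rightarrow> real \<Rightarrow> real \<Rightarrow> nat \<Rightarrow> real ^ 'n \<Rightarrow>
    (nat \<Rightarrow> real ^ 'n) \<Rightarrow> (nat \<Rightarrow> real ^ 'n) \<Rightarrow> (nat \<Rightarrow> real ^ 'n) \<Rightarrow> bool" where
  "extragradient_sliding P Q \<eta> \<theta> K x0 x u u' \<longleftrightarrow>
     x 0 = x0 \<and>
     (\<forall>k<K. sliding_operator P Q \<theta> (x k) (u' k) = 0 \<and>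
            x (Suc k) = x k - \<eta> *\<^sub>R (P (u k) + Q (u k)))"

end

theory Submission
  imports Defs
begin

text \<open>
  Put \<open>z = x k\<close> and \<open>B = sliding_operator P Q \<theta> z\<close>. Strong monotonicity of \<open>B\<close> turns the accuracy
  condition, which refers to the unknown zero of \<open>B\<close>, into \<open>\<parallel>B (u k)\<parallel> \<le> Lp \<parallel>z - u k\<parallel>\<close>. As
  \<open>R (u k) - (z - u k) / \<theta> = B (u k) + (P (u k) - P z)\<close>, the vector \<open>R (u k)\<close> is then within
  \<open>\<parallel>z - u k\<parallel> / \<theta>\<close> of \<open>(z - u k) / \<theta>\<close>, that is, \<open>\<theta> \<parallel>R (u k)\<parallel>\<^sup>2 \<le> 2 \<langle>R (u k), z - u k\<rangle>\<close>. Together with the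
  Minty condition, a step therefore decreases \<open>\<parallel>x k - xstar\<parallel>\<^sup>2\<close> by at least
  \<open>\<eta> (\<theta> - \<eta>) \<parallel>R (u k)\<parallel>\<^sup>2\<close>, and these decreases telescope.
\<close>

text \<open>The operator is \<open>1 / \<theta>\<close>-strongly monotone in its last argument and
  vanishes at \<open>v\<close>; pair its value at \<open>u\<close> with \<open>u - v\<close> and
  apply Cauchy-Schwarz.\<close>

lemma sliding_operator_error_bound:
  fixes P Q :: "real ^ 'n \<Rightarrow> real ^ 'n"
  assumes "monotone_operator Q" and "\<theta> > 0" and zero: "sliding_operator P Q \<theta> z v = 0"
  shows "norm (u - v) \<le> \<theta> * norm (sliding_operator P Q \<theta> z u)"
proof -
  let ?B = "sliding_operator P Q \<theta> z"
  have "?B u = Q u - Q v + (1 / \<theta>) *\<^sub>R (u - v)"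
    using zero unfolding sliding_operator_def by (simp add: algebra_simps add_eq_0_iff)
  then have "?B u \<bullet> (u - v) = (Q u - Q v) \<bullet> (u - v) + (norm (u - v))\<^sup>2 / \<theta>"
    by (simp add: inner_add_left power2_norm_eq_inner)
  moreover have "(Q u - Q v) \<bullet> (u - v) \<ge> 0"
    using assms(1) unfolding monotone_operator_def by blast
  ultimately have "(norm (u - v))\<^sup>2 / \<theta> \<le> norm (?B u) * norm (u - v)"
    using norm_cauchy_schwarz[of "?B u" "u - v"] by linarith
  then have "norm (u - v) * norm (u - v) \<le> (\<theta> * norm (?B u)) * norm (u - v)"
    using \<open>\<theta> > 0\<close> by (simp add: field_simps power2_eq_square)
  then show ?thesis
    using \<open>\<theta> > 0\<close> by (cases "u = v") simp_all
qed

text \<open>If the residual \<open>b\<close> exceeded \<open>L * norm (z - u)\<close>, the error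
  bound \<open>L * norm (u - v) \<le> b / 2\<close> would give
  \<open>L * norm (z - v) \<le> 3 / 2 * b\<close>. The factor 1/3 in the accuracy condition then
  yields \<open>b\<^sup>2 \<le> 3 / 4 * b\<^sup>2\<close>, which is absurd for
  \<open>b > 0\<close>.\<close>

lemma sliding_operator_residual_bound:
  fixes P Q :: "real ^ 'n \<Rightarrow> real ^ 'n"
  assumes "monotone_operator Q" and "L > 0"
    and "sliding_operator P Q (1 / (2 * L)) z v = 0"
    and acc: "(norm (sliding_operator P Q (1 / (2 * L)) z u))\<^sup>2 \<le> L\<^sup>2 / 3 * (norm (z - v))\<^sup>2"
  shows "norm (sliding_operator P Q (1 / (2 * L)) z u) \<le> L * norm (z - u)"
proof (rule ccontr)
  define b where "b = norm (sliding_operator P Q (1 / (2 * L)) z u)"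
  assume "\<not> ?thesis"
  then have less: "L * norm (z - u) < b"
    by (simp add: b_def)
  then have "b > 0"
    using \<open>L > 0\<close> by (smt (verit) mult_nonneg_nonneg norm_ge_zero)
  have "norm (u - v) \<le> 1 / (2 * L) * b"
    using sliding_operator_error_bound[OF assms(1) _ assms(3)] \<open>L > 0\<close> by (simp add: b_def)
  then have "L * norm (u - v) \<le> b / 2"
    using \<open>L > 0\<close> by (simp add: field_simps)
  moreover have "L * norm (z - v) \<le> L * norm (z - u) + L * norm (u - v)"
    using norm_triangle_ineq[of "z - u" "u - v"] \<open>L > 0\<close>
    by (simp flip: distrib_left)
  ultimately have "L * norm (z - v) \<le> 3 / 2 * b"
    using less by linarith
  then have "(L * norm (z - v))\<^sup>2 \<le> (3 / 2 * b)\<^sup>2"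
    using \<open>L > 0\<close> by (intro power_mono) auto
  moreover have "b\<^sup>2 \<le> (L * norm (z - v))\<^sup>2 / 3"
    using acc by (simp add: b_def power_mult_distrib)
  moreover have "b\<^sup>2 > 0"
    using \<open>b > 0\<close> by simp
  ultimately show False
    by (simp add: power_mult_distrib power2_eq_square)
qed

lemma norm_diff_le_imp_inner_ge:
  fixes r w :: "'a::real_inner"
  assumes "norm (r - w) \<le> norm w"
  shows "(norm r)\<^sup>2 \<le> 2 * (r \<bullet> w)"
proof -
  have "(norm (r - w))\<^sup>2 \<le> (norm w)\<^sup>2"
    using assms by (intro power_mono) auto
  then show ?thesis
    by (simp add: power2_norm_eq_inner inner_diff inner_commute)
qed

text \<open>For \<open>\<theta> = 1 / (2 * L)\<close> the stepsize \<open>1 / (4 * L)\<close> is the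
  maximiser \<open>\<theta> / 2\<close> of \<open>\<eta> * (\<theta> - \<eta>)\<close>; the maximum
  \<open>\<theta>\<^sup>2 / 4\<close> is the constant \<open>1 / (16 * L\<^sup>2)\<close>.\<close>

lemma extragradient_sliding_descent:
  fixes P Q :: "real ^ 'n \<Rightarrow> real ^ 'n"
  assumes "monotone_operator Q" and "L-lipschitz_on UNIV P" and "L > 0"
    and "sliding_operator P Q (1 / (2 * L)) z v = 0"
    and "(norm (sliding_operator P Q (1 / (2 * L)) z u))\<^sup>2 \<le> L\<^sup>2 / 3 * (norm (z - v))\<^sup>2"
    and minty: "(P u + Q u) \<bullet> (u - s) \<ge> 0"
  shows "(norm (P u + Q u))\<^sup>2 / (16 * L\<^sup>2) \<le>
    (norm (z - s))\<^sup>2 - (norm (z - (1 / (4 * L)) *\<^sub>R (P u + Q u) - s))\<^sup>2"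
proof -
  let ?B = "sliding_operator P Q (1 / (2 * L)) z"
  define r where "r = P u + Q u"
  have "norm (P u - P z) \<le> L * norm (z - u)"
    using lipschitz_onD[OF assms(2), of u z] by (simp add: dist_norm norm_minus_commute)
  moreover have "norm (?B u) \<le> L * norm (z - u)"
    by (rule sliding_operator_residual_bound[OF assms(1,3,4,5)])
  moreover have "r - (2 * L) *\<^sub>R (z - u) = ?B u + (P u - P z)"
    by (simp add: r_def sliding_operator_def algebra_simps)
  \<comment> \<open>Each of the two summands costs at most \<open>L * norm (z - u)\<close>, which
    uses up the radius \<open>2 * L * norm (z - u)\<close> exactly.\<close>
  ultimately have "norm (r - (2 * L) *\<^sub>R (z - u)) \<le> norm ((2 * L) *\<^sub>R (z - u))"
    using norm_triangle_ineq[of "?B u" "P u - P z"] \<open>L > 0\<close> by simp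
  then have "(norm r)\<^sup>2 \<le> 4 * L * (r \<bullet> (z - u))"
    using norm_diff_le_imp_inner_ge by fastforce
  \<comment> \<open>Split \<open>z - s\<close> as \<open>(z - u) + (u - s)\<close>; the second part
    contributes a nonnegative amount by the Minty condition.\<close>
  also have "\<dots> \<le> 4 * L * (r \<bullet> (z - s))"
    using minty \<open>L > 0\<close> by (simp add: r_def inner_diff_right)
  finally have "(norm r)\<^sup>2 / (8 * L\<^sup>2) \<le> (r \<bullet> (z - s)) / (2 * L)"
    using \<open>L > 0\<close> by (simp add: field_simps power2_eq_square)
  \<comment> \<open>The cross term gains at least twice the quadratic term, so one copy of
    \<open>(norm r)\<^sup>2 / (16 * L\<^sup>2)\<close> survives.\<close>
  moreover have "(norm (z - (1 / (4 * L)) *\<^sub>R r - s))\<^sup>2 =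
      (norm (z - s))\<^sup>2 - (r \<bullet> (z - s)) / (2 * L) + (norm r)\<^sup>2 / (16 * L\<^sup>2)"
  proof -
    have "(norm (a - b))\<^sup>2 = (norm a)\<^sup>2 - 2 * (b \<bullet> a) + (norm b)\<^sup>2" for a b :: "real ^ 'n"
      by (simp add: power2_norm_eq_inner inner_diff inner_commute)
    from this[of "z - s" "(1 / (4 * L)) *\<^sub>R r"] show ?thesis
      by (simp add: power_divide power_mult_distrib diff_diff_eq add.commute)
  qed
  ultimately show ?thesis
    by (simp add: r_def)
qed

lemma Min_le_average:
  fixes f :: "'a \<Rightarrow> real"
  assumes "finite A" and "A \<noteq> {}"
  shows "(MIN a\<in>A. f a) \<le> (\<Sum>a\<in>A. f a) / real (card A)"
proof -
  have "real (card A) * (MIN a\<in>A. f a) \<le> (\<Sum>a\<in>A. f a)"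
    using assms by (intro sum_bounded_below) simp
  then show ?thesis
    using assms by (simp add: card_gt_0_iff field_simps)
qed

theorem theorem1:
  fixes P Q R :: "real ^ 'n \<Rightarrow> real ^ 'n"
    and xstar x0 :: "real ^ 'n"
    and x u u' :: "nat \<Rightarrow> real ^ 'n"
    and Lp Lq \<theta> \<eta> :: real
    and K :: nat
  assumes R: "R = (\<lambda>y. P y + Q y)"
    and minty: "\<And>y. R y \<bullet> (y - xstar) \<ge> 0"
    and Q_lipschitz: "Lq-lipschitz_on UNIV Q"
    and Q_monotone: "monotone_operator Q"
    and P_lipschitz: "Lp-lipschitz_on UNIV P"
    and Lp_pos: "Lp > 0"
    and K_pos: "K \<ge> 1"
    and theta: "\<theta> = 1 / (2 * Lp)"
    and eta: "\<eta> = \<theta> / 2"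
    and run: "extragradient_sliding P Q \<eta> \<theta> K x0 x u u'"
    and accuracy: "\<And>k. k < K \<Longrightarrow>
      (norm (sliding_operator P Q \<theta> (x k) (u k)))\<^sup>2 \<le> Lp\<^sup>2 / 3 * (norm (x k - u' k))\<^sup>2"
  shows "(MIN j\<in>{..<K}. (norm (R (u j)))\<^sup>2) \<le> 16 * Lp\<^sup>2 * (norm (x0 - xstar))\<^sup>2 / real K"
proof -
  have step: "(norm (R (u k)))\<^sup>2 \<le>
      16 * Lp\<^sup>2 * ((norm (x k - xstar))\<^sup>2 - (norm (x (Suc k) - xstar))\<^sup>2)" if "k < K" for k
  proof -
    have zero: "sliding_operator P Q (1 / (2 * Lp)) (x k) (u' k) = 0"
      and next_x: "x (Suc k) = x k - (1 / (4 * Lp)) *\<^sub>R (P (u k) + Q (u k))"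
      using run that by (simp_all add: extragradient_sliding_def theta eta)
    have "(norm (R (u k)))\<^sup>2 / (16 * Lp\<^sup>2) \<le> (norm (x k - xstar))\<^sup>2 - (norm (x (Suc k) - xstar))\<^sup>2"
      using extragradient_sliding_descent[OF Q_monotone P_lipschitz Lp_pos zero, of "u k" xstar]
        accuracy[OF that] minty[of "u k"]
      by (simp add: R theta next_x)
    then show ?thesis
      using Lp_pos by (simp add: field_simps)
  qed
  have "(\<Sum>k<K. (norm (R (u k)))\<^sup>2) \<le>
      (\<Sum>k<K. 16 * Lp\<^sup>2 * ((norm (x k - xstar))\<^sup>2 - (norm (x (Suc k) - xstar))\<^sup>2))"
    by (intro sum_mono step) simp
  also have "\<dots> = 16 * Lp\<^sup>2 * ((norm (x 0 - xstar))\<^sup>2 - (norm (x K - xstar))\<^sup>2)"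
    using sum_lessThan_telescope'[of "\<lambda>k. (norm (x k - xstar))\<^sup>2" K]
    by (simp flip: sum_distrib_left)
  also have "\<dots> \<le> 16 * Lp\<^sup>2 * (norm (x0 - xstar))\<^sup>2"
    using run by (intro mult_left_mono) (simp_all add: extragradient_sliding_def)
  finally have "(\<Sum>k<K. (norm (R (u k)))\<^sup>2) / real K \<le> 16 * Lp\<^sup>2 * (norm (x0 - xstar))\<^sup>2 / real K"
    by (rule divide_right_mono) simp
  \<comment> \<open>\<open>K \<ge> 1\<close> keeps the index set nonempty, so that
    \<open>MIN\<close> is a true minimum.\<close>
  moreover have "(MIN j\<in>{..<K}. (norm (R (u j)))\<^sup>2) \<le> (\<Sum>k<K. (norm (R (u k)))\<^sup>2) / real K"
    using Min_le_average[of "{..<K}" "\<lambda>j. (norm (R (u j)))\<^sup>2"] K_pos by (simp add: lessThan_empty_iff)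
  ultimately show ?thesis
    by linarith
qed

end
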